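(* There exists $n_0$ such that for every $n \ge n_0$ the following holds. Let $\mathcal{F}$ be a family of at least $2^{0.44n}$ subsets of $[n]$. Then there exist sets $A, B, C, D, E, F \in \mathcal{F}$ with $A \ne B$, $C \ne D$, $E \ne F$ such that the symmetric differences $A \triangle B$, $C \triangle D$ and $E \triangle F$ are pairwise disjoint.
   Context: $[n]=\{1,\dots,n\}$; $\triangle$ denotes symmetric difference of sets. *)

theory Defs
  imports Complex_Main
begin

end

theory Submission
  imports Defs "HOL-Analysis.Convex" "HOL-Real_Asymp.Real_Asymp"
begin

text \<open>
  A family of rate \<open>c\<close> contains two distinct sets at distance at most \<open>\<delta> n\<close> as soon as
  \<open>c > H(\<rho>)\<close> and \<open>2 sqrt (\<rho> (1 - \<rho>)) > 1 - 2 \<delta>\<close>, where \<open>H\<close> is the binary entropy: the first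
  linear programming bound for codes, proved as by Navon and Samorodnitsky from a function
  supported on a Hamming ball of radius \<open>\<rho> n\<close> on which the adjacency operator of the cube acts with
  eigenvalue close to \<open>2 sqrt (\<rho> (1 - \<rho>)) n\<close>.  With \<open>\<rho> = 1/11\<close> rate \<open>0.44\<close> gives \<open>A \<triangle> B\<close> of size
  at most \<open>0.214 n\<close>.  Enlarge it to a set \<open>S\<close> of size \<open>\<lfloor>0.214 n\<rfloor>\<close>; by pigeonhole many members agree
  on \<open>S\<close>, and outside \<open>S\<close> they form a family of rate at least \<open>23/80 = 0.2875\<close>.  With \<open>\<rho> = 1/20\<close>
  two of these, \<open>C\<close> and \<open>D\<close>, are at relative distance at most \<open>0.285 < 0.2875\<close>, so the family is too
  large for its traces on \<open>C \<triangle> D\<close> to be distinct; this gives \<open>E\<close> and \<open>F\<close>.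
\<close>

section \<open>Walsh characters of the cube\<close>

text \<open>For finite \<open>U\<close> this is \<open>(-1) ^ card (U \<inter> S)\<close>; as a
  product, its multiplicativity is checked factor by factor.\<close>

definition walsh :: "'a set \<Rightarrow> 'a set \<Rightarrow> real"
  where "walsh U S = (\<Prod>x\<in>U. if x \<in> S then - 1 else 1)"

lemma walsh_sym_diff_right: "walsh U (sym_diff A B) = walsh U A * walsh U B"
  unfolding walsh_def prod.distrib[symmetric] by (rule prod.cong) auto

lemma walsh_square: "walsh U S * walsh U S = 1"
  unfolding walsh_def prod.distrib[symmetric] by (rule prod.neutral) auto

lemma walsh_empty_right [simp]: "walsh U {} = 1"
  by (simp add: walsh_def)

lemma walsh_flip:
  assumes "finite U"
  shows "walsh (sym_diff U {i}) S = (if i \<in> S then - 1 else 1) * walsh U S"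
proof (cases "i \<in> U")
  case True
  then have "sym_diff U {i} = U - {i}" by auto
  moreover have "walsh U S = (if i \<in> S then - 1 else 1) * walsh (U - {i}) S"
    unfolding walsh_def by (rule prod.remove[OF assms True])
  ultimately show ?thesis by simp
next
  case False
  then have "sym_diff U {i} = insert i U" by auto
  with False assms show ?thesis by (simp add: walsh_def)
qed

text \<open>This is the eigenvalue of the adjacency operator of the cube at the character indexed by
  \<open>S\<close>.\<close>

lemma sum_signs:
  assumes "finite X" "S \<subseteq> X"
  shows "(\<Sum>i\<in>X. if i \<in> S then - 1 else 1 :: real) = real (card X) - 2 * real (card S)"
proof -
  have "(\<Sum>i\<in>X. if i \<in> S then - 1 else 1 :: real) = (\<Sum>i\<in>X. 1 - 2 * (if i \<in> S then 1 else 0))"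
    by (rule sum.cong) auto
  also have "\<dots> = real (card X) - 2 * (\<Sum>i\<in>X. if i \<in> S then 1 else 0)"
    by (simp add: sum_subtractf sum_distrib_left)
  also have "(\<Sum>i\<in>X. if i \<in> S then 1 else 0 :: real) = real (card S)"
    using assms by (simp add: sum.If_cases Int_absorb1)
  finally show ?thesis .
qed

text \<open>Flipping \<open>i\<close> is an involution of \<open>Pow X\<close> that multiplies
  \<open>walsh U S\<close> by the sign of \<open>i\<close>; these signs add up to the
  eigenvalue.\<close>

lemma walsh_transform_neighbours:
  assumes "finite X" "S \<subseteq> X"
  shows "(real (card X) - 2 * real (card S)) * (\<Sum>U\<in>Pow X. f U * walsh U S)
    = (\<Sum>U\<in>Pow X. (\<Sum>i\<in>X. f (sym_diff U {i})) * walsh U S)"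
proof -
  let ?s = "\<lambda>i. if i \<in> S then - 1 else 1 :: real"
  have "(real (card X) - 2 * real (card S)) * (\<Sum>U\<in>Pow X. f U * walsh U S)
    = (\<Sum>i\<in>X. \<Sum>U\<in>Pow X. ?s i * (f U * walsh U S))"
    by (simp only: sum_signs[OF assms, symmetric] sum_product)
  also have "\<dots> = (\<Sum>i\<in>X. \<Sum>U\<in>Pow X. f (sym_diff U {i}) * walsh U S)"
  proof (rule sum.cong[OF refl])
    fix i assume i: "i \<in> X"
    have inv: "sym_diff (sym_diff U {i}) {i} = U" for U by auto
    have w: "walsh (sym_diff U {i}) S = ?s i * walsh U S" if "U \<in> Pow X" for U
      using that finite_subset[OF _ assms(1)] by (intro walsh_flip) auto
    show "(\<Sum>U\<in>Pow X. ?s i * (f U * walsh U S)) = (\<Sum>U\<in>Pow X. f (sym_diff U {i}) * walsh U S)"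
    proof (rule sum.reindex_bij_witness[where i = "\<lambda>U. sym_diff U {i}" and j = "\<lambda>U. sym_diff U {i}"])
      fix U assume U: "U \<in> Pow X"
      show "f (sym_diff (sym_diff U {i}) {i}) * walsh (sym_diff U {i}) S = ?s i * (f U * walsh U S)"
        unfolding inv w[OF U] by simp
    qed (use i in auto)
  qed
  also have "\<dots> = (\<Sum>U\<in>Pow X. (\<Sum>i\<in>X. f (sym_diff U {i})) * walsh U S)"
    by (subst sum.swap) (simp add: sum_distrib_right)
  finally show ?thesis .
qed

section \<open>The linear programming bound for codes\<close>

text \<open>
  Write \<open>f^\<close> for the Walsh transform of \<open>f\<close>.  The function \<open>G S = 2 (d - card S) (f^ S)\<^sup>2\<close> is
  nonpositive on all nonzero differences of the code, and its Walsh coefficients are nonnegative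
  because \<open>2 d - 2 card S\<close> corresponds to the adjacency operator minus \<open>n - 2 d\<close>.
  Compare the two evaluations of the sum of \<open>G\<close> over all differences.
\<close>

lemma card_code_le:
  fixes f :: "'a set \<Rightarrow> real" and d \<mu> :: real
  assumes X: "finite X" and F: "F \<subseteq> Pow X" and B: "B \<subseteq> Pow X"
    and nonneg: "\<And>U. f U \<ge> 0" and supp: "\<And>U. U \<subseteq> X \<Longrightarrow> f U \<noteq> 0 \<Longrightarrow> U \<in> B"
    and nz: "V \<subseteq> X" "f V \<noteq> 0"
    and eig: "\<And>U. U \<subseteq> X \<Longrightarrow> \<mu> * f U \<le> (\<Sum>i\<in>X. f (sym_diff U {i}))"
    and dist: "\<And>A B. A \<in> F \<Longrightarrow> B \<in> F \<Longrightarrow> A \<noteq> B \<Longrightarrow> d \<le> real (card (sym_diff A B))"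
    and d: "d \<ge> 0" and \<mu>: "real (card X) - 2 * d \<le> \<mu>"
  shows "real (card F) * (\<mu> - real (card X) + 2 * d) \<le> 2 * d * real (card B)"
proof -
  define n where "n = real (card X)"
  define fh where "fh S = (\<Sum>U\<in>Pow X. f U * walsh U S)" for S
  \<comment> \<open>The Walsh transform of \<open>a\<close> is \<open>2 * d - 2 * card S\<close>
    times that of \<open>f\<close>, so \<open>G\<close> is the product of the transforms of
    \<open>a\<close> and \<open>f\<close>.\<close>
  define a where "a U = (\<Sum>i\<in>X. f (sym_diff U {i})) - (n - 2 * d) * f U" for U
  define G where "G S = (2 * d - 2 * real (card S)) * (fh S)\<^sup>2" for S
  define Q where "Q = (\<Sum>U\<in>Pow X. (f U)\<^sup>2)"
  have finF: "finite F" and finB: "finite B" and finP: "finite (Pow X)"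
    using X F B by (auto intro: finite_subset)
  have a_ge: "a U \<ge> (\<mu> - n + 2 * d) * f U" if "U \<in> Pow X" for U
    using eig[of U] that by (simp add: a_def algebra_simps)
  have a_nonneg: "a U \<ge> 0" if "U \<in> Pow X" for U
  proof -
    have "0 \<le> (\<mu> - n + 2 * d) * f U" using \<mu> nonneg by (simp add: n_def)
    with a_ge[OF that] show ?thesis by linarith
  qed
  have G_eq: "G S = (\<Sum>U\<in>Pow X. \<Sum>V\<in>Pow X. a U * f V * (walsh U S * walsh V S))" if "S \<subseteq> X" for S
  proof -
    have "(2 * d - 2 * real (card S)) * fh S = (\<Sum>U\<in>Pow X. a U * walsh U S)"
      using walsh_transform_neighbours[OF X that, of f]
      by (simp add: a_def fh_def n_def sum_subtractf sum_distrib_left[symmetric] left_diff_distrib mult.assoc)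
    then have "G S = (\<Sum>U\<in>Pow X. a U * walsh U S) * (\<Sum>V\<in>Pow X. f V * walsh V S)"
      by (simp add: G_def power2_eq_square fh_def flip: mult.assoc)
    also have "\<dots> = (\<Sum>U\<in>Pow X. \<Sum>V\<in>Pow X. a U * f V * (walsh U S * walsh V S))"
      by (simp add: sum_product mult_ac)
    finally show ?thesis .
  qed
  have sub: "sym_diff A C \<subseteq> X" if "A \<in> F" "C \<in> F" for A C
    using that F by auto
  have "(\<Sum>A\<in>F. \<Sum>C\<in>F. G (sym_diff A C))
      = (\<Sum>A\<in>F. \<Sum>C\<in>F. \<Sum>U\<in>Pow X. \<Sum>V\<in>Pow X. a U * f V *
            ((walsh U A * walsh V A) * (walsh U C * walsh V C)))"
    using sub by (intro sum.cong refl) (simp add: G_eq walsh_sym_diff_right mult_ac)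
  also have "\<dots> = (\<Sum>U\<in>Pow X. \<Sum>V\<in>Pow X. \<Sum>A\<in>F. \<Sum>C\<in>F. a U * f V *
            ((walsh U A * walsh V A) * (walsh U C * walsh V C)))"
    apply (subst (2) sum.swap)
    apply (subst (1) sum.swap)
    apply (subst (3) sum.swap)
    apply (subst (2) sum.swap)
    by (rule refl)
  \<comment> \<open>For fixed \<open>U\<close> and \<open>V\<close> the sum over pairs of code words
    factors into a square, so every term is nonnegative.\<close>
  also have "\<dots> = (\<Sum>U\<in>Pow X. \<Sum>V\<in>Pow X. a U * f V * (\<Sum>A\<in>F. walsh U A * walsh V A)\<^sup>2)"
    by (simp only: power2_eq_square sum_product) (simp only: sum_distrib_left)
  finally have total: "(\<Sum>A\<in>F. \<Sum>C\<in>F. G (sym_diff A C)) = \<dots>" .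
  have "(\<mu> - n + 2 * d) * Q * (real (card F))\<^sup>2 \<le> (\<Sum>U\<in>Pow X. a U * f U * (real (card F))\<^sup>2)"
    unfolding Q_def sum_distrib_left sum_distrib_right
  proof (rule sum_mono)
    fix U assume U: "U \<in> Pow X"
    have "(\<mu> - n + 2 * d) * f U * f U * (real (card F))\<^sup>2 \<le> a U * f U * (real (card F))\<^sup>2"
      using a_ge[OF U] nonneg by (intro mult_right_mono) auto
    then show "(\<mu> - n + 2 * d) * (f U)\<^sup>2 * (real (card F))\<^sup>2 \<le> a U * f U * (real (card F))\<^sup>2"
      by (simp add: power2_eq_square mult_ac)
  qed
  \<comment> \<open>Only the diagonal \<open>V = U\<close> is kept; there the inner sum is
    \<open>card F\<close>.\<close>
  also have "\<dots> \<le> (\<Sum>U\<in>Pow X. \<Sum>V\<in>Pow X. a U * f V * (\<Sum>A\<in>F. walsh U A * walsh V A)\<^sup>2)"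
  proof (rule sum_mono)
    fix U assume U: "U \<in> Pow X"
    have "a U * f U * (real (card F))\<^sup>2 = a U * f U * (\<Sum>A\<in>F. walsh U A * walsh U A)\<^sup>2"
      by (simp add: walsh_square)
    also have "\<dots> \<le> (\<Sum>V\<in>Pow X. a U * f V * (\<Sum>A\<in>F. walsh U A * walsh V A)\<^sup>2)"
      using U a_nonneg nonneg finP by (intro member_le_sum[of U]) auto
    finally show "a U * f U * (real (card F))\<^sup>2 \<le> \<dots>" .
  qed
  also have "\<dots> = (\<Sum>A\<in>F. \<Sum>C\<in>F. G (sym_diff A C))" by (rule total[symmetric])
  also have "\<dots> \<le> (\<Sum>A\<in>F. G {})"
  proof (rule sum_mono)
    fix A assume A: "A \<in> F"
    have "(\<Sum>C\<in>F - {A}. G (sym_diff A C)) \<le> 0"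
      unfolding G_def
    proof (intro sum_nonpos mult_nonpos_nonneg)
      fix C assume "C \<in> F - {A}"
      then show "2 * d - 2 * real (card (sym_diff A C)) \<le> 0"
        using dist[OF A, of C] by auto
    qed simp
    moreover have "(\<Sum>C\<in>F. G (sym_diff A C)) = G (sym_diff A A) + (\<Sum>C\<in>F - {A}. G (sym_diff A C))"
      by (rule sum.remove[OF finF A])
    ultimately show "(\<Sum>C\<in>F. G (sym_diff A C)) \<le> G {}" by simp
  qed
  also have "\<dots> = real (card F) * (2 * d * (\<Sum>U\<in>Pow X. f U)\<^sup>2)"
    by (simp add: G_def fh_def)
  also have "\<dots> \<le> real (card F) * (2 * d * (real (card B) * Q))"
  proof -
    have "(\<Sum>U\<in>Pow X. f U) = (\<Sum>U\<in>B. f U)"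
      using supp B finP by (intro sum.mono_neutral_right) auto
    moreover have "Q = (\<Sum>U\<in>B. (f U)\<^sup>2)"
      unfolding Q_def using supp B finP by (intro sum.mono_neutral_right) auto
    \<comment> \<open>Cauchy-Schwarz on the support: here the size of \<open>B\<close>
      enters.\<close>
    moreover have "(\<Sum>U\<in>B. f U)\<^sup>2 \<le> real (card B) * (\<Sum>U\<in>B. (f U)\<^sup>2)"
      using sum_squared_le_sum_of_squares[of f B] by (simp add: mult.commute)
    ultimately show ?thesis using d by (intro mult_left_mono) auto
  qed
  finally have main: "(\<mu> - n + 2 * d) * Q * (real (card F))\<^sup>2 \<le> real (card F) * (2 * d * (real (card B) * Q))" .
  have "Q > 0"
    unfolding Q_def using nz supp B by (intro sum_pos2[OF finP, of V]) auto
  show ?thesis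
  proof (cases "card F = 0")
    case True
    then show ?thesis using d by simp
  next
    case False
    have "(Q * real (card F)) * (real (card F) * (\<mu> - n + 2 * d)) \<le> (Q * real (card F)) * (2 * d * real (card B))"
      using main by (simp add: power2_eq_square mult_ac)
    with \<open>Q > 0\<close> False show ?thesis by (simp add: n_def)
  qed
qed


section \<open>Approximate eigenfunctions supported on a ball\<close>

text \<open>Removing a point of \<open>U\<close> goes one layer down, adding a point one layer up.
  For empty \<open>U\<close> the truncated \<open>card U - 1\<close> is harmless because its
  coefficient is \<open>0\<close>.\<close>

lemma sum_neighbours_card:
  fixes g :: "nat \<Rightarrow> real"
  assumes X: "finite X" and U: "U \<subseteq> X"
  shows "(\<Sum>i\<in>X. g (card (sym_diff U {i})))
    = real (card U) * g (card U - 1) + (real (card X) - real (card U)) * g (card U + 1)"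
proof -
  have finU: "finite U" using X U by (rule finite_subset[rotated])
  have "(\<Sum>i\<in>X. g (card (sym_diff U {i})))
      = (\<Sum>i\<in>X - U. g (card (sym_diff U {i}))) + (\<Sum>i\<in>U. g (card (sym_diff U {i})))"
    by (rule sum.subset_diff[OF U X])
  also have "(\<Sum>i\<in>X - U. g (card (sym_diff U {i}))) = (\<Sum>i\<in>X - U. g (card U + 1))"
  proof (rule sum.cong[OF refl])
    fix i assume "i \<in> X - U"
    moreover from this have "sym_diff U {i} = insert i U" by auto
    ultimately show "g (card (sym_diff U {i})) = g (card U + 1)" using finU by simp
  qed
  also have "(\<Sum>i\<in>U. g (card (sym_diff U {i}))) = (\<Sum>i\<in>U. g (card U - 1))"
  proof (rule sum.cong[OF refl])
    fix i assume "i \<in> U"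
    moreover from this have "sym_diff U {i} = U - {i}" by auto
    ultimately show "g (card (sym_diff U {i})) = g (card U - 1)" using finU by simp
  qed
  finally show ?thesis
    using card_mono[OF X U] by (simp add: card_Diff_subset[OF finU U] of_nat_diff)
qed

text \<open>
  Any fixed concave bump of width \<open>m\<close> has \<open>h (w - 1) + h (w + 1)\<close> almost \<open>2 h w\<close>; weighted by
  \<open>q ^ w\<close> with \<open>q = sqrt (\<rho> / (1 - \<rho>))\<close> it gives both neighbours the same coefficient.
\<close>

definition bump :: "nat \<Rightarrow> nat \<Rightarrow> nat \<Rightarrow> real"
  where "bump s m w = (if s < w \<and> w \<le> s + m then (real w - real s) * (real s + real m + 1 - real w) else 0)"

lemma bump_nonneg: "bump s m w \<ge> 0"
  by (auto simp: bump_def)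

text \<open>On its window the bump is a quadratic with second difference \<open>-2\<close> and
  values at least \<open>m\<close>, so the defect \<open>2\<close> is at most \<open>2 / m\<close>
  times the value.\<close>

lemma bump_neighbours:
  assumes "s < w" "w \<le> s + m"
  shows "2 * (1 - 1 / real m) * bump s m w \<le> bump s m (w - 1) + bump s m (w + 1)"
proof -
  obtain j where j: "w = s + Suc j" "j < m"
    using assms less_imp_Suc_add[of s w] by auto
  \<comment> \<open>The formula also covers the layers \<open>i = 0\<close> and
    \<open>i = m + 1\<close> just outside the window, where both sides vanish.\<close>
  have *: "bump s m (s + i) = real i * (real m + 1 - real i)" if "i \<le> m + 1" for i
    using that by (cases "i = m + 1") (auto simp: bump_def)
  have eqs: "bump s m w = (real j + 1) * (real m - real j)"
    "bump s m (w - 1) = real j * (real m + 1 - real j)"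
    "bump s m (w + 1) = (real j + 2) * (real m - 1 - real j)"
    using *[of "Suc j"] *[of j] *[of "j + 2"] j by (simp_all add: algebra_simps)
  have "real j * (real m - 1 - real j) \<ge> 0"
    using j by (intro mult_nonneg_nonneg) auto
  then have "real m \<le> bump s m w"
    unfolding eqs by (simp add: algebra_simps)
  then have "1 \<le> 1 / real m * bump s m w"
    using j by (simp add: field_simps)
  moreover have "bump s m (w - 1) + bump s m (w + 1) = 2 * bump s m w - 2"
    unfolding eqs by (simp add: algebra_simps)
  ultimately show ?thesis by (simp add: algebra_simps)
qed

text \<open>With \<open>q ^ w\<close> factored out, the lower and upper neighbours carry the
  coefficients \<open>w / q\<close> and \<open>(card X - w) * q\<close>. On the window
  \<open>low\<close> and \<open>high\<close> make both at least \<open>\<kappa>\<close>.\<close>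

lemma weighted_bump_eigen:
  fixes q \<kappa> :: real
  assumes X: "finite X" and U: "U \<subseteq> X" and q: "q > 0" and m: "m \<ge> 1" and \<kappa>: "\<kappa> \<ge> 0"
    and low: "\<kappa> * q \<le> real s" and high: "\<kappa> \<le> (real (card X) - real (s + m)) * q"
  defines "f \<equiv> \<lambda>U. bump s m (card U) * q ^ card U"
  shows "2 * (1 - 1 / real m) * \<kappa> * f U \<le> (\<Sum>i\<in>X. f (sym_diff U {i}))"
proof -
  define w where "w = card U"
  have f_nonneg: "f V \<ge> 0" for V
    using q by (simp add: f_def bump_nonneg)
  show ?thesis
  proof (cases "s < w \<and> w \<le> s + m")
    case False
    then have "f U = 0" by (auto simp: f_def bump_def w_def)
    then show ?thesis using f_nonneg by (simp add: sum_nonneg)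
  next
    case True
    then have w: "s < w" "w \<le> s + m" by auto
    have qw: "q ^ (w - 1) = q ^ w / q"
      using w q by (simp add: power_diff)
    have "2 * (1 - 1 / real m) * \<kappa> * f U = \<kappa> * q ^ w * (2 * (1 - 1 / real m) * bump s m w)"
      by (simp add: f_def w_def)
    also have "\<dots> \<le> \<kappa> * q ^ w * (bump s m (w - 1) + bump s m (w + 1))"
      using bump_neighbours[OF w] \<kappa> q by (intro mult_left_mono) auto
    also have "\<dots> = \<kappa> * (bump s m (w - 1) * q ^ w) + \<kappa> * (bump s m (w + 1) * q ^ w)"
      by (simp add: algebra_simps)
    also have "\<dots> \<le> real w / q * (bump s m (w - 1) * q ^ w)
        + (real (card X) - real w) * q * (bump s m (w + 1) * q ^ w)"
    proof (intro add_mono mult_right_mono)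
      show "\<kappa> \<le> real w / q" using low w q by (simp add: field_simps)
      have "(real (card X) - real (s + m)) * q \<le> (real (card X) - real w) * q"
        using w q by (intro mult_right_mono) auto
      with high show "\<kappa> \<le> (real (card X) - real w) * q" by linarith
    qed (use q bump_nonneg in auto)
    also have "\<dots> = (\<Sum>i\<in>X. f (sym_diff U {i}))"
      unfolding f_def sum_neighbours_card[OF X U, of "\<lambda>k. bump s m k * q ^ k"] w_def[symmetric] qw
      by simp
    finally show ?thesis .
  qed
qed

text \<open>Under the product measure of bias \<open>\<rho>\<close>, each set in the ball has
  probability at least \<open>2 powr (- H(\<rho>) * card X)\<close>, the power in the statement; the
  total probability is \<open>1\<close>.\<close>

lemma card_ball_le:
  fixes \<rho> :: real
  assumes X: "finite X" and \<rho>: "0 < \<rho>" "\<rho> \<le> 1 / 2"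
  shows "real (card {U \<in> Pow X. real (card U) \<le> \<rho> * real (card X)})
    * (\<rho> powr \<rho> * (1 - \<rho>) powr (1 - \<rho>)) ^ card X \<le> 1"
proof -
  define n where "n = card X"
  let ?B = "{U \<in> Pow X. real (card U) \<le> \<rho> * real n}"
  let ?v = "(\<rho> powr \<rho> * (1 - \<rho>) powr (1 - \<rho>)) ^ n"
  have v: "?v = \<rho> powr (\<rho> * real n) * (1 - \<rho>) powr (real n - \<rho> * real n)"
    using \<rho> by (simp add: power_mult_distrib powr_powr left_diff_distrib flip: powr_realpow)
  have "real (card ?B) * ?v = (\<Sum>U\<in>?B. ?v)" by simp
  also have "\<dots> \<le> (\<Sum>U\<in>?B. \<rho> ^ card U * (1 - \<rho>) ^ card (X - U))"
  proof (rule sum_mono)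
    fix U assume U: "U \<in> ?B"
    then have le: "card U \<le> n" and fin: "finite U"
      using card_mono[OF X] finite_subset[OF _ X] by (auto simp: n_def)
    have k: "real (card U) \<le> \<rho> * real n" using U by simp
    have "?v = \<rho> powr real (card U) * \<rho> powr (\<rho> * real n - real (card U))
        * (1 - \<rho>) powr (real n - \<rho> * real n)"
      unfolding v by (simp flip: powr_add)
    \<comment> \<open>Since \<open>\<rho> \<le> 1 - \<rho>\<close>, the surplus exponent of
      \<open>\<rho>\<close> may be moved to \<open>1 - \<rho>\<close>.\<close>
    also have "\<dots> \<le> \<rho> powr real (card U) * (1 - \<rho>) powr (\<rho> * real n - real (card U))
        * (1 - \<rho>) powr (real n - \<rho> * real n)"
      using \<rho> k by (intro mult_right_mono mult_left_mono powr_mono2) auto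
    also have "\<dots> = \<rho> powr real (card U) * (1 - \<rho>) powr real (n - card U)"
      using le by (simp add: of_nat_diff mult.assoc flip: powr_add)
    also have "\<dots> = \<rho> ^ card U * (1 - \<rho>) ^ card (X - U)"
      using \<rho> U fin by (simp add: powr_realpow card_Diff_subset n_def)
    finally show "?v \<le> \<dots>" .
  qed
  also have "\<dots> \<le> (\<Sum>U\<in>Pow X. \<rho> ^ card U * (1 - \<rho>) ^ card (X - U))"
    using \<rho> X by (intro sum_mono2) auto
  also have "\<dots> = 1"
    using prod_add[OF X, of "\<lambda>_. \<rho>" "\<lambda>_. 1 - \<rho>"] by simp
  finally show ?thesis by (simp add: n_def)
qed

section \<open>Close pairs in families of given rate\<close>

text \<open>Assumption \<open>c\<close> is \<open>c > H(\<rho>)\<close> without logarithms. If there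
  were no close pair, the code bound and the ball bound would keep
  \<open>(2 powr c * \<eta>) ^ n\<close> below the constant
  \<open>4 * \<delta> / \<epsilon>\<close>.\<close>

lemma close_pair:
  fixes \<rho> \<delta> c :: real
  assumes \<rho>: "0 < \<rho>" "\<rho> \<le> 1 / 2" and \<delta>: "\<delta> \<ge> 0" "1 - 2 * \<delta> < 2 * sqrt (\<rho> * (1 - \<rho>))"
    and c: "1 < 2 powr c * (\<rho> powr \<rho> * (1 - \<rho>) powr (1 - \<rho>))"
  shows "\<exists>N. \<forall>X. \<forall>F :: 'a set set. finite X \<and> N \<le> card X \<and> F \<subseteq> Pow X \<and>
    2 powr (c * real (card X)) \<le> real (card F) \<longrightarrow>
    (\<exists>A\<in>F. \<exists>B\<in>F. A \<noteq> B \<and> real (card (sym_diff A B)) \<le> \<delta> * real (card X))"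
proof -
  define \<eta> where "\<eta> = \<rho> powr \<rho> * (1 - \<rho>) powr (1 - \<rho>)"
  define \<theta> where "\<theta> = sqrt (\<rho> * (1 - \<rho>))"
  \<comment> \<open>This ratio balances both constraints: \<open>\<theta> * n\<close> times
    \<open>q\<close> is \<open>\<rho> * n\<close>, and \<open>(1 - \<rho>) * n * q\<close> is
    \<open>\<theta> * n\<close>.\<close>
  define q where "q = sqrt (\<rho> / (1 - \<rho>))"
  have q: "q > 0" and \<eta>: "\<eta> > 0" and \<theta>: "\<theta> > 0" using \<rho> by (auto simp: q_def \<eta>_def \<theta>_def)
  have q\<theta>: "\<theta> * q = \<rho>" "(1 - \<rho>) * q = \<theta>"
  proof -
    have "\<theta> * q = sqrt (\<rho> * \<rho>)"
      using \<rho> unfolding \<theta>_def q_def real_sqrt_mult[symmetric] by simp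
    then show "\<theta> * q = \<rho>" using \<rho> by simp
    have "(1 - \<rho>) * q = sqrt ((1 - \<rho>) * (1 - \<rho>)) * q" using \<rho> by simp
    also have "\<dots> = \<theta>"
      using \<rho> unfolding \<theta>_def q_def real_sqrt_mult[symmetric] by (simp add: mult.commute)
    finally show "(1 - \<rho>) * q = \<theta>" .
  qed
  \<comment> \<open>The width \<open>m\<close> is fixed before \<open>n\<close>; the strict bound on
    \<open>\<delta>\<close> leaves room for the factor \<open>1 - 1 / m\<close>.\<close>
  have "\<forall>\<^sub>F m in sequentially. 1 - 2 * \<delta> < 2 * (1 - 1 / real m) * \<theta>"
  proof (rule order_tendstoD(1))
    show "(\<lambda>m. 2 * (1 - 1 / real m) * \<theta>) \<longlonglongrightarrow> 2 * \<theta>" by real_asymp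
  qed (use \<delta> in \<open>simp add: \<theta>_def\<close>)
  then obtain m where m: "m \<ge> 1" "1 - 2 * \<delta> < 2 * (1 - 1 / real m) * \<theta>"
    using eventually_conj[OF _ eventually_ge_at_top[of 1]] eventually_happens'[of sequentially]
    by (metis (mono_tags, lifting) sequentially_bot)
  define \<epsilon> where "\<epsilon> = 2 * (1 - 1 / real m) * \<theta> - 1 + 2 * \<delta>"
  have \<epsilon>: "\<epsilon> > 0" using m by (simp add: \<epsilon>_def)
  \<comment> \<open>\<open>K\<close> is the loss from lowering \<open>\<kappa>\<close> by
    \<open>(m + 1) / q\<close>; being independent of \<open>n\<close>, it is absorbed by half of the
    margin \<open>\<epsilon> * n\<close>.\<close>
  define K where "K = 2 * (1 - 1 / real m) * ((real m + 1) / q)"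
  have "2 powr c * \<eta> > 1" using c by (simp add: \<eta>_def)
  then obtain N where N: "4 * \<delta> / \<epsilon> < (2 powr c * \<eta>) ^ N"
    using real_arch_pow by blast
  have "\<forall>\<^sub>F n in sequentially. \<rho> * real n \<ge> real m + 2"
    using \<rho> by real_asymp
  moreover have "\<forall>\<^sub>F n in sequentially. \<epsilon> * real n / 2 \<ge> K"
    using \<epsilon> by real_asymp
  ultimately have "\<forall>\<^sub>F n in sequentially. \<rho> * real n \<ge> real m + 2 \<and> \<epsilon> * real n / 2 \<ge> K \<and> N \<le> n \<and> 0 < n"
    using eventually_ge_at_top[of N] eventually_gt_at_top[of 0] by eventually_elim auto
  then obtain M where M: "\<And>n. n \<ge> M \<Longrightarrow> \<rho> * real n \<ge> real m + 2 \<and> \<epsilon> * real n / 2 \<ge> K \<and> N \<le> n \<and> 0 < n"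
    unfolding eventually_sequentially by blast
  show ?thesis
  proof (intro exI[of _ M] allI impI, elim conjE, rule ccontr)
    fix X :: "'a set" and F
    assume X0: "finite X" "M \<le> card X" and F0: "F \<subseteq> Pow X" "2 powr (c * real (card X)) \<le> real (card F)"
    assume no: "\<not> (\<exists>A\<in>F. \<exists>B\<in>F. A \<noteq> B \<and> real (card (sym_diff A B)) \<le> \<delta> * real (card X))"
    define n where "n = card X"
    have X: "finite X" "card X = n" and F: "F \<subseteq> Pow X" "2 powr (c * real n) \<le> real (card F)"
      using X0 F0 by (simp_all add: n_def)
    have ev: "\<rho> * real n \<ge> real m + 2" "\<epsilon> * real n / 2 \<ge> K" "N \<le> n" "0 < n"
      using M[OF X0(2)] by (simp_all add: n_def)
    have far: "\<delta> * real n \<le> real (card (sym_diff A B))" if "A \<in> F" "B \<in> F" "A \<noteq> B" for A B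
      using that no by (force simp: n_def)
    define r where "r = nat \<lfloor>\<rho> * real n\<rfloor>"
    \<comment> \<open>The window is the top \<open>m\<close> layers of the ball, sizes
      \<open>s + 1\<close> to \<open>r\<close>.\<close>
    define s where "s = r - m"
    have r: "real r \<le> \<rho> * real n" "\<rho> * real n < real r + 1"
      using \<rho> unfolding r_def by (simp_all add: of_nat_floor)
    have rm: "r > m" using r ev(1) by linarith
    then have s: "s + m = r" "real s = real r - real m" by (simp_all add: s_def of_nat_diff)
    define f where "f U = bump s m (card U) * q ^ card U" for U :: "'a set"
    \<comment> \<open>The subtracted term pays for the window width and the rounding of
      \<open>\<rho> * n\<close>, giving \<open>\<kappa> * q \<le> s\<close>.\<close>
    define \<kappa> where "\<kappa> = \<theta> * real n - (real m + 1) / q"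
    define \<mu> where "\<mu> = 2 * (1 - 1 / real m) * \<kappa>"
    define B where "B = {U \<in> Pow X. real (card U) \<le> \<rho> * real n}"
    have \<kappa>q: "\<kappa> * q = \<rho> * real n - (real m + 1)"
    proof -
      have "\<kappa> * q = (\<theta> * q) * real n - (real m + 1) / q * q"
        unfolding \<kappa>_def left_diff_distrib by simp
      then show ?thesis using q by (simp add: q\<theta>)
    qed
    have "\<kappa> * q \<ge> 0" using \<kappa>q ev(1) by linarith
    then have \<kappa>: "\<kappa> \<ge> 0" using q by (simp add: zero_le_mult_iff)
    have low: "\<kappa> * q \<le> real s" using \<kappa>q r s by linarith
    have "\<kappa> \<le> \<theta> * real n" using q by (simp add: \<kappa>_def)
    also have "\<dots> = (real n - \<rho> * real n) * q"
      unfolding q\<theta>(2)[symmetric] by (simp add: algebra_simps)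
    also have "\<dots> \<le> (real (card X) - real (s + m)) * q"
      using r s q X by (intro mult_right_mono) auto
    finally have high: "\<kappa> \<le> (real (card X) - real (s + m)) * q" .
    have \<mu>_eq: "\<mu> - real n + 2 * (\<delta> * real n) = \<epsilon> * real n - K"
      by (simp add: \<mu>_def \<kappa>_def \<epsilon>_def K_def algebra_simps)
    have "\<epsilon> * real n > 0" using \<epsilon> ev by simp
    then have \<mu>_ge: "\<epsilon> * real n / 2 \<le> \<mu> - real n + 2 * (\<delta> * real n)" "0 \<le> \<mu> - real n + 2 * (\<delta> * real n)"
      unfolding \<mu>_eq using ev(2) by linarith+
    have "real (s + 1) \<le> real (card X)"
    proof -
      have "\<rho> * real n \<le> 1 * real n" using \<rho> by (intro mult_right_mono) auto
      then show ?thesis using r s m X by linarith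
    qed
    then obtain V where V: "V \<subseteq> X" "card V = s + 1"
      using obtain_subset_with_card_n[of "s + 1" X] by auto
    have bound: "real (card F) * (\<mu> - real (card X) + 2 * (\<delta> * real n)) \<le> 2 * (\<delta> * real n) * real (card B)"
    proof (rule card_code_le[where f = f and V = V])
      show "f U \<ge> 0" for U using q by (simp add: f_def bump_nonneg)
      show "U \<in> B" if "U \<subseteq> X" "f U \<noteq> 0" for U
        using that r s by (auto simp: f_def bump_def B_def split: if_splits)
      show "f V \<noteq> 0" using V q m by (simp add: f_def bump_def)
      show "\<mu> * f U \<le> (\<Sum>i\<in>X. f (sym_diff U {i}))" if "U \<subseteq> X" for U
        using weighted_bump_eigen[OF X(1) that q m(1) \<kappa> low high] by (simp add: f_def \<mu>_def)
      show "real (card X) - 2 * (\<delta> * real n) \<le> \<mu>" using \<mu>_ge(2) X by simp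
    qed (use X F V far \<delta> in \<open>auto simp: B_def\<close>)
    have "real (card F) * (\<epsilon> * real n / 2) \<le> real (card F) * (\<mu> - real n + 2 * (\<delta> * real n))"
      using \<mu>_ge(1) by (rule mult_left_mono) simp
    also have "\<dots> \<le> 2 * (\<delta> * real n) * real (card B)" using bound X by simp
    finally have "real n * (real (card F) * \<epsilon>) \<le> real n * (4 * \<delta> * real (card B))"
      by (simp add: mult_ac)
    then have "real (card F) * \<epsilon> \<le> 4 * \<delta> * real (card B)" using ev by simp
    moreover have "2 powr (c * real n) * \<epsilon> \<le> real (card F) * \<epsilon>"
      using F \<epsilon> by (intro mult_right_mono) auto
    ultimately have "2 powr (c * real n) * \<epsilon> \<le> 4 * \<delta> * real (card B)" by linarith
    then have "2 powr (c * real n) * \<epsilon> * \<eta> ^ n \<le> 4 * \<delta> * real (card B) * \<eta> ^ n"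
      using \<eta> by (intro mult_right_mono) auto
    also have "\<dots> = 4 * \<delta> * (real (card B) * \<eta> ^ n)" by simp
    also have "\<dots> \<le> 4 * \<delta> * 1"
      using card_ball_le[OF X(1) \<rho>] \<delta> X by (intro mult_left_mono) (auto simp: B_def \<eta>_def)
    finally have "(2 powr c * \<eta>) ^ n \<le> 4 * \<delta> / \<epsilon>"
      using \<epsilon> by (simp add: power_mult_distrib powr_power field_simps)
    moreover have "(2 powr c * \<eta>) ^ N \<le> (2 powr c * \<eta>) ^ n"
      using ev \<open>2 powr c * \<eta> > 1\<close> by (intro power_increasing) auto
    ultimately show False using N by linarith
  qed
qed

section \<open>Pigeonhole and numerical estimates\<close>

lemma obtain_large_fibre:
  assumes "finite S" "finite F"
  obtains P where "card F \<le> 2 ^ card S * card {A \<in> F. A \<inter> S = P}"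
proof -
  have "\<exists>P\<in>Pow S. card F \<le> 2 ^ card S * card {A \<in> F. A \<inter> S = P}"
  proof (rule ccontr)
    assume "\<not> ?thesis"
    then have less: "2 ^ card S * card {A \<in> F. A \<inter> S = P} < card F" if "P \<in> Pow S" for P
      using that by (simp add: not_le)
    have "card F = (\<Sum>P\<in>Pow S. card {A \<in> F. A \<inter> S = P})"
      using sum.group[of F "Pow S" "\<lambda>A. A \<inter> S" "\<lambda>_. 1::nat"] assms by (simp add: image_subset_iff)
    then have "2 ^ card S * card F = (\<Sum>P\<in>Pow S. 2 ^ card S * card {A \<in> F. A \<inter> S = P})"
      by (simp only: sum_distrib_left)
    also have "\<dots> < (\<Sum>P\<in>Pow S. card F)"
      by (intro sum_strict_mono less) (use assms in auto)
    also have "\<dots> = 2 ^ card S * card F" using assms by (simp add: card_Pow)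
    finally show False by simp
  qed
  then show thesis using that by blast
qed

text \<open>The power 275, a common multiple of 25 and 11, makes all exponents integral: the claim
  becomes \<open>11 ^ 275 < 2 ^ 121 * 10 ^ 250\<close>.\<close>

lemma rate_11: "1 < 2 powr 0.44 * ((1 / 11) powr (1 / 11) * (1 - 1 / 11) powr (1 - 1 / 11 :: real))"
  (is "1 < ?x")
proof (rule ccontr)
  assume "\<not> 1 < ?x"
  then have "?x ^ 275 \<le> 1" by (intro power_le_one) auto
  moreover have "?x ^ 275 = 2 ^ 121 * ((1 / 11) ^ 25 * (10 / 11) ^ 250)"
    by (simp add: power_mult_distrib powr_power)
  ultimately show False by (simp add: power_divide)
qed

text \<open>Likewise the power 80 reduces this to \<open>20 ^ 80 < 2 ^ 23 * 19 ^ 76\<close>.\<close>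

lemma rate_20: "1 < 2 powr (23 / 80) * ((1 / 20) powr (1 / 20) * (1 - 1 / 20) powr (1 - 1 / 20 :: real))"
  (is "1 < ?x")
proof (rule ccontr)
  assume "\<not> 1 < ?x"
  then have "?x ^ 80 \<le> 1" by (intro power_le_one) auto
  moreover have "?x ^ 80 = 2 ^ 23 * ((1 / 20) ^ 4 * (19 / 20) ^ 76)"
    by (simp add: power_mult_distrib powr_power)
  ultimately show False by (simp add: power_divide)
qed

section \<open>Three pairwise disjoint differences\<close>

theorem theorem4p1:
  shows "\<exists>n0::nat. \<forall>n\<ge>n0. \<forall>\<F>::nat set set.
     \<F> \<subseteq> Pow {1..n} \<and> real (card \<F>) \<ge> 2 powr (0.44 * real n) \<longrightarrow>
     (\<exists>A\<in>\<F>. \<exists>B\<in>\<F>. \<exists>C\<in>\<F>. \<exists>D\<in>\<F>. \<exists>E\<in>\<F>. \<exists>F\<in>\<F>.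
        A \<noteq> B \<and> C \<noteq> D \<and> E \<noteq> F \<and>
        ((A - B) \<union> (B - A)) \<inter> ((C - D) \<union> (D - C)) = {} \<and>
        ((A - B) \<union> (B - A)) \<inter> ((E - F) \<union> (F - E)) = {} \<and>
        ((C - D) \<union> (D - C)) \<inter> ((E - F) \<union> (F - E)) = {})"
proof -
  have root_11: "1 - 2 * (107 / 500) < 2 * sqrt (1 / 11 * (1 - 1 / 11))"
  proof -
    have "143 / 500 < sqrt (1 / 11 * (1 - 1 / 11))"
      by (rule real_less_rsqrt) (simp add: power2_eq_square)
    then show ?thesis by simp
  qed
  have root_20: "1 - 2 * (57 / 200) < 2 * sqrt (1 / 20 * (1 - 1 / 20))"
  proof -
    have "43 / 200 < sqrt (1 / 20 * (1 - 1 / 20))"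
      by (rule real_less_rsqrt) (simp add: power2_eq_square)
    then show ?thesis by simp
  qed
  obtain N1 where N1: "\<forall>X. \<forall>F :: nat set set. finite X \<and> N1 \<le> card X \<and> F \<subseteq> Pow X \<and>
    2 powr (0.44 * real (card X)) \<le> real (card F) \<longrightarrow>
    (\<exists>A\<in>F. \<exists>B\<in>F. A \<noteq> B \<and> real (card (sym_diff A B)) \<le> 107 / 500 * real (card X))"
    by (rule exE[OF close_pair[OF _ _ _ root_11 rate_11]]) (simp, simp, simp, blast)
  obtain N2 where N2: "\<forall>X. \<forall>F :: nat set set. finite X \<and> N2 \<le> card X \<and> F \<subseteq> Pow X \<and>
    2 powr (23 / 80 * real (card X)) \<le> real (card F) \<longrightarrow>
    (\<exists>A\<in>F. \<exists>B\<in>F. A \<noteq> B \<and> real (card (sym_diff A B)) \<le> 57 / 200 * real (card X))"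
    by (rule exE[OF close_pair[OF _ _ _ root_20 rate_20]]) (simp, simp, simp, blast)
  show ?thesis
  \<comment> \<open>The complement of \<open>S\<close> keeps more than half of the points, hence
    \<open>2 * N2\<close>; the \<open>1\<close> makes \<open>k\<close> positive.\<close>
  proof (intro exI[of _ "N1 + 2 * N2 + 1"] allI impI, elim conjE)
    fix n :: nat and \<F> :: "nat set set"
    assume n: "n \<ge> N1 + 2 * N2 + 1" and sub: "\<F> \<subseteq> Pow {1..n}"
      and large: "2 powr (0.44 * real n) \<le> real (card \<F>)"
    have fin: "finite \<F>" using sub by (rule finite_subset) simp
    obtain A B where AB: "A \<in> \<F>" "B \<in> \<F>" "A \<noteq> B" "real (card (sym_diff A B)) \<le> 107 / 500 * real n"
      using N1[rule_format, of "{1..n}" \<F>] n sub large by auto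
    define t where "t = nat \<lfloor>107 / 500 * real n\<rfloor>"
    have t: "real t \<le> 107 / 500 * real n" unfolding t_def by (rule of_nat_floor) simp
    have "card (sym_diff A B) \<le> t" using AB(4) by (simp add: t_def le_nat_floor)
    moreover have "sym_diff A B \<subseteq> {1..n}" using AB(1,2) sub by auto
    moreover have "t \<le> card {1..n}" using t by simp
    ultimately obtain S where S: "sym_diff A B \<subseteq> S" "S \<subseteq> {1..n}" "card S = t"
      using exists_subset_between[of "sym_diff A B" t "{1..n}"] by auto
    have finS: "finite S" using S(2) by (rule finite_subset) simp
    obtain P where P: "card \<F> \<le> 2 ^ card S * card {A \<in> \<F>. A \<inter> S = P}"
      using obtain_large_fibre[OF finS fin] .
    define G where "G = {A \<in> \<F>. A \<inter> S = P}"
    have finG: "finite G" using fin by (simp add: G_def)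
    define k where "k = card ({1..n} - S)"
    have k: "real k = real n - real t"
      using S t finS by (simp add: k_def card_Diff_subset of_nat_diff)
    have k_large: "k \<ge> N2" "k > 0" using n k t by linarith+
    have rate: "(0.44 :: real) = 11 / 25" by simp
    have "2 powr (23 / 80 * real k) * 2 ^ t = 2 powr (23 / 80 * real k + real t)"
      by (simp add: powr_add powr_realpow)
    also have "\<dots> \<le> 2 powr (0.44 * real n)" proof (rule powr_mono)
      \<comment> \<open>With \<open>k = n - t\<close> this is \<open>57 * t \<le> 12.2 * n\<close>,
        barely met by \<open>t \<le> 0.214 * n\<close> since
        \<open>57 * 0.214 = 12.198\<close>.\<close>
      show "23 / 80 * real k + real t \<le> 0.44 * real n"
        unfolding rate k using t of_nat_0_le_iff[of n, where 'a = real]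
        unfolding right_diff_distrib by linarith
    qed simp
    also have "\<dots> \<le> real (2 ^ card S * card G)" using large P by (simp add: G_def flip: of_nat_le_iff[where 'a = real])
    finally have G: "2 powr (23 / 80 * real k) \<le> real (card G)" using S by simp
    have inj: "inj_on (\<lambda>A. A - S) G" by (rule inj_onI) (auto simp: G_def)
    have "\<exists>A\<in>(\<lambda>A. A - S) ` G. \<exists>B\<in>(\<lambda>A. A - S) ` G. A \<noteq> B \<and> real (card (sym_diff A B)) \<le> 57 / 200 * real k"
      unfolding k_def using k_large G sub card_image[OF inj]
      by (intro N2[rule_format]) (auto simp: k_def G_def)
    then obtain C D where CD: "C \<in> G" "D \<in> G" "C \<noteq> D"
      "real (card (sym_diff (C - S) (D - S))) \<le> 57 / 200 * real k" by blast
    have "sym_diff (C - S) (D - S) = sym_diff C D" using CD(1,2) by (auto simp: G_def)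
    with CD(4) have T: "real (card (sym_diff C D)) < 23 / 80 * real k" using k_large by simp
    have finT: "finite (sym_diff C D)"
      by (rule finite_subset[of _ "{1..n}"]) (use CD(1,2) sub in \<open>auto simp: G_def\<close>)
    have "real (2 ^ card (sym_diff C D)) = 2 powr real (card (sym_diff C D))" by (simp add: powr_realpow)
    also have "\<dots> < 2 powr (23 / 80 * real k)" using T by simp
    finally have less: "2 ^ card (sym_diff C D) < card G" using G by linarith
    \<comment> \<open>Two members of \<open>G\<close> with equal traces on
      \<open>sym_diff C D\<close> differ only outside it, and outside \<open>S\<close> because all
      of \<open>G\<close> agrees on \<open>S\<close>.\<close>
    have "\<not> inj_on (\<lambda>A. A \<inter> sym_diff C D) G"
    proof
      assume "inj_on (\<lambda>A. A \<inter> sym_diff C D) G"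
      then have "card G \<le> card (Pow (sym_diff C D))"
        by (rule card_inj_on_le) (use finT in auto)
      with less finT show False by (simp add: card_Pow)
    qed
    then obtain E F where EF: "E \<in> G" "F \<in> G" "E \<noteq> F" "E \<inter> sym_diff C D = F \<inter> sym_diff C D"
      by (auto simp: inj_on_def)
    have disj: "sym_diff A B \<inter> sym_diff C D = {}" "sym_diff A B \<inter> sym_diff E F = {}"
      using S(1) CD(1,2) EF(1,2) by (auto simp: G_def)
    have disj': "sym_diff C D \<inter> sym_diff E F = {}" using EF(4) by auto
    have mem: "C \<in> \<F>" "D \<in> \<F>" "E \<in> \<F>" "F \<in> \<F>" using CD EF by (auto simp: G_def)
    show "\<exists>A\<in>\<F>. \<exists>B\<in>\<F>. \<exists>C\<in>\<F>. \<exists>D\<in>\<F>. \<exists>E\<in>\<F>. \<exists>F\<in>\<F>.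
        A \<noteq> B \<and> C \<noteq> D \<and> E \<noteq> F \<and>
        ((A - B) \<union> (B - A)) \<inter> ((C - D) \<union> (D - C)) = {} \<and>
        ((A - B) \<union> (B - A)) \<inter> ((E - F) \<union> (F - E)) = {} \<and>
        ((C - D) \<union> (D - C)) \<inter> ((E - F) \<union> (F - E)) = {}"
      by (rule bexI[of _ A], rule bexI[of _ B], rule bexI[of _ C], rule bexI[of _ D],
          rule bexI[of _ E], rule bexI[of _ F], intro conjI)
        (fact AB CD EF disj disj' mem)+
  qed
qed

end
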